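(* Let $\lambda_0,\lambda_1>0$ be real with $\lambda_0^2+\lambda_1^2=1$ and $\lambda_0^2\neq\frac12$, and let $0<v<u<1$ be real with $u^2+v^2=1$. Let $P_Q(a,b,c)$, $a,b,c\in\{\bar0,\bar1_0,\bar1_1\}$, be the distribution given, with $u_0=u$, $v_0=v$, $u_1=v$, $v_1=-u$ and $i,j,k\in\{0,1\}$, by $$P_Q(\bar1_i,\bar0,\bar0)=P_Q(\bar0,\bar1_i,\bar0)=P_Q(\bar0,\bar0,\bar1_i)=\lambda_1^4\lambda_0^2u_i^2+\lambda_0^4\lambda_1^2v_i^2,$$ $$P_Q(\bar1_i,\bar1_j,\bar1_k)=(\lambda_1^3u_iu_ju_k+\lambda_0^3v_iv_jv_k)^2,$$ $$P_Q(\bar1_i,\bar1_j,\bar0)=P_Q(\bar1_i,\bar0,\bar1_j)=P_Q(\bar0,\bar1_i,\bar1_j)=P_Q(\bar0,\bar0,\bar0)=0.$$ If $$3(\lambda_1^3u^2v-\lambda_0^3uv^2)^2-3u^2(\lambda_1^6+\lambda_0^6)+2\big(\lambda_0^6+(\lambda_1^3u^3+\lambda_0^3v^3)^2\big)+\lambda_1^6+(\lambda_1^3v^3-\lambda_0^3u^3)^2<0,$$ then $P_Q$ is not triangle-local.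
   Context: Triangle-local: a distribution $P(a,b,c)$ is triangle-local if there are independent random variables $\alpha,\beta,\gamma$ (with arbitrary distributions $\mu,\eta,\nu$) and conditional distributions $P_A(a|\beta,\gamma)$, $P_B(b|\gamma,\alpha)$, $P_C(c|\alpha,\beta)$ such that $P(a,b,c)=\int d\mu(\alpha)\,d\eta(\beta)\,d\nu(\gamma)\,P_A(a|\beta,\gamma)P_B(b|\gamma,\alpha)P_C(c|\alpha,\beta)$. The distribution $P_Q$ is the one obtained from the state $|\Psi\rangle=|\psi\rangle_{A_2B_1}\otimes|\psi\rangle_{B_2C_1}\otimes|\psi\rangle_{C_2A_1}$ with $|\psi\rangle=\lambda_0|01\rangle+\lambda_1|10\rangle$, each party measuring its two qubits ($A_1A_2$, $B_1B_2$, $C_1C_2$ respectively) with projectors $\Pi_{\bar0}=|00\rangle\langle00|+|11\rangle\langle11|$, $\Pi_{\bar1_t}=|\bar1_t\rangle\langle\bar1_t|$, $|\bar1_t\rangle=u_t|01\rangle+v_t|10\rangle$ for $t\in\{0,1\}$. *)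

theory Defs
  imports "HOL-Probability.Probability"
begin

section \<open>Triangle-local distributions\<close>

text \<open>
  \<open>response M N R\<close>: \<open>R o x y\<close> is a conditional probability of the output \<open>o\<close> given the values
  \<open>x\<close>, \<open>y\<close> of the two sources with laws \<open>M\<close> and \<open>N\<close>.
\<close>

definition response ::
  "'x measure \<Rightarrow> 'y measure \<Rightarrow> ('o::finite \<Rightarrow> 'x \<Rightarrow> 'y \<Rightarrow> real) \<Rightarrow> bool"
where
  "response M N R \<longleftrightarrow>
     (\<forall>k. (\<lambda>(x, y). R k x y) \<in> borel_measurable (M \<Otimes>\<^sub>M N)) \<and>
     (\<forall>k. \<forall>x\<in>space M. \<forall>y\<in>space N. 0 \<le> R k x y) \<and>
     (\<forall>x\<in>space M. \<forall>y\<in>space N. (\<Sum>k\<in>UNIV. R k x y) = 1)"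

text \<open>
  The sources are arbitrary probability spaces.  HOL has no quantification over types, so the
  types in which the three sources take values are a parameter.  A distribution is triangle-local
  iff the predicate holds for some choice of these types; that it is not triangle-local is
  expressed by a theorem in which \<open>'x\<close>, \<open>'y\<close>, \<open>'z\<close> are free (hence universally quantified)
  type variables.
\<close>

definition triangle_local ::
  "('x \<times> 'y \<times> 'z) itself \<Rightarrow> ('a::finite \<Rightarrow> 'b::finite \<Rightarrow> 'c::finite \<Rightarrow> real) \<Rightarrow> bool"
where
  "triangle_local _ P \<longleftrightarrow>
     (\<exists>(\<mu> :: 'x measure) (\<eta> :: 'y measure) (\<nu> :: 'z measure) PA PB PC.
        prob_space \<mu> \<and> prob_space \<eta> \<and> prob_space \<nu> \<and>
        response \<eta> \<nu> PA \<and> response \<nu> \<mu> PB \<and> response \<mu> \<eta> PC \<and>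
        (\<forall>a b c. P a b c =
           (\<integral>(\<alpha>, \<beta>, \<gamma>). PA a \<beta> \<gamma> * PB b \<gamma> \<alpha> * PC c \<alpha> \<beta> \<partial>(\<mu> \<Otimes>\<^sub>M (\<eta> \<Otimes>\<^sub>M \<nu>)))))"


section \<open>The distribution \<open>P_Q\<close>\<close>

text \<open>\<open>Zero\<close> is the output $\bar 0$, and \<open>One t\<close> is $\bar 1_t$ with \<open>False\<close>, \<open>True\<close> for $t = 0, 1$;
  \<open>l0\<close>, \<open>l1\<close> are $\lambda_0$, $\lambda_1$.\<close>

datatype outcome = Zero | One bool

lemma UNIV_outcome: "UNIV = {Zero, One False, One True}"
  by (auto intro: outcome.exhaust)

instance outcome :: finite
  by standard (simp add: UNIV_outcome)

definition coeff_u :: "real \<Rightarrow> real \<Rightarrow> bool \<Rightarrow> real" where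
  "coeff_u u v t = (if t then v else u)"

definition coeff_v :: "real \<Rightarrow> real \<Rightarrow> bool \<Rightarrow> real" where
  "coeff_v u v t = (if t then - u else v)"

definition P_one :: "real \<Rightarrow> real \<Rightarrow> real \<Rightarrow> real \<Rightarrow> bool \<Rightarrow> real" where
  "P_one l0 l1 u v i =
     l1 ^ 4 * l0\<^sup>2 * (coeff_u u v i)\<^sup>2 + l0 ^ 4 * l1\<^sup>2 * (coeff_v u v i)\<^sup>2"

definition P_three :: "real \<Rightarrow> real \<Rightarrow> real \<Rightarrow> real \<Rightarrow> bool \<Rightarrow> bool \<Rightarrow> bool \<Rightarrow> real" where
  "P_three l0 l1 u v i j k =
     (l1 ^ 3 * coeff_u u v i * coeff_u u v j * coeff_u u v k
      + l0 ^ 3 * coeff_v u v i * coeff_v u v j * coeff_v u v k)\<^sup>2"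

fun P_Q :: "real \<Rightarrow> real \<Rightarrow> real \<Rightarrow> real \<Rightarrow> outcome \<Rightarrow> outcome \<Rightarrow> outcome \<Rightarrow> real" where
  "P_Q l0 l1 u v (One i) Zero Zero = P_one l0 l1 u v i"
| "P_Q l0 l1 u v Zero (One i) Zero = P_one l0 l1 u v i"
| "P_Q l0 l1 u v Zero Zero (One i) = P_one l0 l1 u v i"
| "P_Q l0 l1 u v (One i) (One j) (One k) = P_three l0 l1 u v i j k"
| "P_Q l0 l1 u v (One i) (One j) Zero = 0"
| "P_Q l0 l1 u v (One i) Zero (One j) = 0"
| "P_Q l0 l1 u v Zero (One i) (One j) = 0"
| "P_Q l0 l1 u v Zero Zero Zero = 0"

lemma P_Q_nonneg: "0 \<le> P_Q l0 l1 u v a b c"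
  by (cases "(l0, l1, u, v, a, b, c)" rule: P_Q.cases) (auto simp: P_one_def P_three_def)

lemma P_Q_sum:
  assumes "l0\<^sup>2 + l1\<^sup>2 = 1" and "u\<^sup>2 + v\<^sup>2 = 1"
  shows "(\<Sum>a\<in>UNIV. \<Sum>b\<in>UNIV. \<Sum>c\<in>UNIV. P_Q l0 l1 u v a b c) = 1"
proof -
  have "(\<Sum>a\<in>UNIV. \<Sum>b\<in>UNIV. \<Sum>c\<in>UNIV. P_Q l0 l1 u v a b c)
      = 3 * (u\<^sup>2 + v\<^sup>2) * (l1 ^ 4 * l0\<^sup>2 + l0 ^ 4 * l1\<^sup>2)
        + (u\<^sup>2 + v\<^sup>2) ^ 3 * (l1 ^ 6 + l0 ^ 6)"
    unfolding UNIV_outcome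
    by (simp add: P_one_def P_three_def coeff_u_def coeff_v_def) algebra
  also have "\<dots> = 3 * (l1 ^ 4 * l0\<^sup>2 + l0 ^ 4 * l1\<^sup>2) + (l1 ^ 6 + l0 ^ 6)"
    by (simp add: assms(2))
  also have "\<dots> = (l0\<^sup>2 + l1\<^sup>2) ^ 3"
    by algebra
  finally show ?thesis
    using assms(1) by simp
qed


subsection \<open>\<open>P_Q\<close> is the distribution of the quantum experiment\<close>

text \<open>
  Qubits are indexed by \<open>bool\<close> (\<open>False\<close> for $|0\rangle$, \<open>True\<close> for $|1\rangle$).  All amplitudes
  are real.
\<close>

definition ket_source :: "real \<Rightarrow> real \<Rightarrow> bool \<Rightarrow> bool \<Rightarrow> real" where
  "ket_source l0 l1 q r = (if \<not> q \<and> r then l0 else if q \<and> \<not> r then l1 else 0)"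

text \<open>The arguments of \<open>ket_total\<close> are the qubit pairs $A_1A_2$, $B_1B_2$, $C_1C_2$.\<close>

definition ket_total ::
  "real \<Rightarrow> real \<Rightarrow> bool \<times> bool \<Rightarrow> bool \<times> bool \<Rightarrow> bool \<times> bool \<Rightarrow> real"
where
  "ket_total l0 l1 a b c =
     ket_source l0 l1 (snd a) (fst b) * ket_source l0 l1 (snd b) (fst c)
     * ket_source l0 l1 (snd c) (fst a)"

definition ket_one :: "real \<Rightarrow> real \<Rightarrow> bool \<Rightarrow> bool \<times> bool \<Rightarrow> real" where
  "ket_one u v t x = (if x = (False, True) then coeff_u u v t
                      else if x = (True, False) then coeff_v u v t else 0)"

fun projector :: "real \<Rightarrow> real \<Rightarrow> outcome \<Rightarrow> bool \<times> bool \<Rightarrow> bool \<times> bool \<Rightarrow> real" where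
  "projector u v Zero x y = (if x = y \<and> fst x = snd x then 1 else 0)"
| "projector u v (One t) x y = ket_one u v t x * ket_one u v t y"

definition born ::
  "real \<Rightarrow> real \<Rightarrow> real \<Rightarrow> real \<Rightarrow> outcome \<Rightarrow> outcome \<Rightarrow> outcome \<Rightarrow> real"
where
  "born l0 l1 u v a b c =
     (\<Sum>x\<in>UNIV. \<Sum>y\<in>UNIV. \<Sum>z\<in>UNIV. \<Sum>x'\<in>UNIV. \<Sum>y'\<in>UNIV. \<Sum>z'\<in>UNIV.
        ket_total l0 l1 x y z
        * (projector u v a x x' * projector u v b y y' * projector u v c z z')
        * ket_total l0 l1 x' y' z')"

lemma sum_ket_total:
  fixes f :: "bool \<times> bool \<Rightarrow> bool \<times> bool \<Rightarrow> bool \<times> bool \<Rightarrow> real"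
  shows "(\<Sum>x\<in>UNIV. \<Sum>y\<in>UNIV. \<Sum>z\<in>UNIV. ket_total l0 l1 x y z * f x y z) =
    (\<Sum>p\<in>UNIV. \<Sum>q\<in>UNIV. \<Sum>r\<in>UNIV.
       (if p then l1 else l0) * (if q then l1 else l0) * (if r then l1 else l0)
       * f (\<not> r, p) (\<not> p, q) (\<not> q, r))"
  by (simp add: UNIV_Times_UNIV[symmetric] sum.cartesian_product[symmetric] UNIV_bool
      ket_total_def ket_source_def del: UNIV_Times_UNIV)

theorem born_eq_P_Q: "born l0 l1 u v a b c = P_Q l0 l1 u v a b c"
proof -
  have "born l0 l1 u v a b c =
    (\<Sum>x\<in>UNIV. \<Sum>y\<in>UNIV. \<Sum>z\<in>UNIV. ket_total l0 l1 x y z *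
      (\<Sum>x'\<in>UNIV. \<Sum>y'\<in>UNIV. \<Sum>z'\<in>UNIV. ket_total l0 l1 x' y' z' *
        (projector u v a x x' * projector u v b y y' * projector u v c z z')))"
    unfolding born_def by (simp only: sum_distrib_left mult_ac)
  also have "\<dots> = P_Q l0 l1 u v a b c"
    unfolding sum_ket_total
    by (cases "(l0, l1, u, v, a, b, c)" rule: P_Q.cases)
      (simp_all add: UNIV_bool ket_one_def P_one_def P_three_def algebra_simps
        power2_eq_square power3_eq_cube power4_eq_xxxx)
  finally show ?thesis .
qed

end

theory Submission
  imports Defs
begin

text \<open>
  Give the output \<open>Zero\<close> the sign $+1$ and the outputs \<open>One t\<close> the sign $-1$.  Since the number
  of outputs \<open>One t\<close> is always odd, the product of the three signs is almost surely $-1$.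
  Each sign depends on two of the three independent sources, so fixing a generic value of one
  source shows that the signs factor as $-hg$, $-gk$, $-kh$ with $h$, $g$, $k$ sign-valued
  functions of a single source each: the direction in which that source sends its token.  As
  $\lambda_0^2 \neq \frac12$, the distribution forces $h$, $g$, $k$ to have the mean
  $\lambda_1^2 - \lambda_0^2$, up to a simultaneous flip, and then determines the joint law of
  each party's output with the common direction $h = g = k = \pm1$.  These laws and the law of
  three outputs \<open>One t\<close> would be marginals of one joint law; the inequality is a certificate
  that no such joint law exists.
\<close>

section \<open>Integration over three independent sources\<close>

lemma integral_triple_eq_iterated:
  fixes f :: "'x \<times> 'y \<times> 'z \<Rightarrow> real"
  assumes "prob_space X" "prob_space Y" "prob_space Z"
    and f [measurable]: "f \<in> borel_measurable (X \<Otimes>\<^sub>M (Y \<Otimes>\<^sub>M Z))"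
    and bound: "\<And>w. w \<in> space (X \<Otimes>\<^sub>M (Y \<Otimes>\<^sub>M Z)) \<Longrightarrow> \<bar>f w\<bar> \<le> B"
  shows "(\<integral>w. f w \<partial>(X \<Otimes>\<^sub>M (Y \<Otimes>\<^sub>M Z))) = (\<integral>x. \<integral>y. \<integral>z. f (x, y, z) \<partial>Z \<partial>Y \<partial>X)"
proof -
  interpret X: prob_space X by fact
  interpret Y: prob_space Y by fact
  interpret Z: prob_space Z by fact
  interpret YZ: pair_prob_space Y Z ..
  interpret XYZ: pair_prob_space X "Y \<Otimes>\<^sub>M Z" ..
  have "integrable (X \<Otimes>\<^sub>M (Y \<Otimes>\<^sub>M Z)) f"
    by (rule XYZ.P.integrable_const_bound[where B=B]) (use bound in auto)
  then have "(\<integral>w. f w \<partial>(X \<Otimes>\<^sub>M (Y \<Otimes>\<^sub>M Z))) = (\<integral>x. \<integral>w. f (x, w) \<partial>(Y \<Otimes>\<^sub>M Z) \<partial>X)"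
    by (rule XYZ.integral_fst'[symmetric])
  also have "\<dots> = (\<integral>x. \<integral>y. \<integral>z. f (x, y, z) \<partial>Z \<partial>Y \<partial>X)"
  proof (rule Bochner_Integration.integral_cong[OF refl])
    fix x assume x: "x \<in> space X"
    have "integrable (Y \<Otimes>\<^sub>M Z) (\<lambda>w. f (x, w))"
      by (rule YZ.P.integrable_const_bound[where B=B])
         (use bound x in \<open>auto simp: space_pair_measure\<close>)
    then show "(\<integral>w. f (x, w) \<partial>(Y \<Otimes>\<^sub>M Z)) = (\<integral>y. \<integral>z. f (x, y, z) \<partial>Z \<partial>Y)"
      by (rule YZ.integral_fst'[symmetric])
  qed
  finally show ?thesis .
qed

lemma (in prob_space) AE_imp_ex:
  assumes "AE x in M. P x"
  shows "\<exists>x\<in>space M. P x"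
proof (rule ccontr)
  assume "\<not> ?thesis"
  with assms AE_space have "AE x in M. False"
    by (auto elim: eventually_elim2)
  then show False by (simp add: AE_False)
qed

section \<open>Rigidity of sign products on the triangle\<close>

text \<open>Every real, 0 included, gets a sign, so functions built with \<open>sign_of\<close> are
  sign-valued everywhere although their data are signs only almost everywhere.\<close>

definition sign_of :: "real \<Rightarrow> real" where "sign_of t = (if t > 0 then 1 else - 1)"

lemma sign_of_cases: "sign_of t = 1 \<or> sign_of t = - 1"
  by (simp add: sign_of_def)

lemma sign_of_measurable [measurable]: "sign_of \<in> borel_measurable borel"
  unfolding sign_of_def by measurable

lemma sign_of_eq: "t = 1 \<or> t = - 1 \<Longrightarrow> sign_of t = t"
  by (auto simp: sign_of_def)

text \<open>A product of numbers in [0, 1] is at most each factor, so absolute values with product 1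
  are all 1.\<close>

lemma unit_of_prod_eq_minus_one:
  fixes a b c :: real
  assumes "\<bar>a\<bar> \<le> 1" "\<bar>b\<bar> \<le> 1" "\<bar>c\<bar> \<le> 1" "a * b * c = - 1"
  shows "(a = 1 \<or> a = - 1) \<and> (b = 1 \<or> b = - 1) \<and> (c = 1 \<or> c = - 1)"
proof -
  have abc: "\<bar>a\<bar> * (\<bar>b\<bar> * \<bar>c\<bar>) = 1"
    using assms(4) by (metis abs_minus_cancel abs_mult abs_one mult.assoc)
  have "\<bar>b\<bar> * \<bar>c\<bar> \<le> \<bar>b\<bar>" "\<bar>b\<bar> * \<bar>c\<bar> \<le> \<bar>c\<bar>"
    using assms by (simp_all add: mult_left_le mult_left_le_one_le)
  moreover have "\<bar>a\<bar> * (\<bar>b\<bar> * \<bar>c\<bar>) \<le> \<bar>b\<bar> * \<bar>c\<bar>" "\<bar>a\<bar> * (\<bar>b\<bar> * \<bar>c\<bar>) \<le> \<bar>a\<bar>"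
    using assms by (auto simp: mult_left_le_one_le intro!: mult_left_le mult_le_one)
  ultimately have "\<bar>a\<bar> = 1" "\<bar>b\<bar> = 1" "\<bar>c\<bar> = 1"
    using assms abc by linarith+
  then show ?thesis by linarith
qed

text \<open>At a generic \<open>x0\<close> the functions \<open>p _ x0\<close> and
  \<open>q x0 _\<close> depend on one source each, and the parity expresses \<open>f\<close> through
  them. For any other generic \<open>x\<close> the parity then reads
  \<open>p z x * g z = q x y * h y\<close>; the left side is free of \<open>y\<close> and the right
  side of \<open>z\<close>, so both equal a constant depending on \<open>x\<close> only.\<close>

lemma triangle_parity_rigidity:
  fixes f :: "'y \<Rightarrow> 'z \<Rightarrow> real" and p :: "'z \<Rightarrow> 'x \<Rightarrow> real" and q :: "'x \<Rightarrow> 'y \<Rightarrow> real"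
  assumes "prob_space X" "prob_space Y" "prob_space Z"
    and [measurable]: "case_prod f \<in> borel_measurable (Y \<Otimes>\<^sub>M Z)"
      "case_prod p \<in> borel_measurable (Z \<Otimes>\<^sub>M X)" "case_prod q \<in> borel_measurable (X \<Otimes>\<^sub>M Y)"
    and f: "\<And>y z. y \<in> space Y \<Longrightarrow> z \<in> space Z \<Longrightarrow> \<bar>f y z\<bar> \<le> 1"
    and p: "\<And>z x. z \<in> space Z \<Longrightarrow> x \<in> space X \<Longrightarrow> \<bar>p z x\<bar> \<le> 1"
    and q: "\<And>x y. x \<in> space X \<Longrightarrow> y \<in> space Y \<Longrightarrow> \<bar>q x y\<bar> \<le> 1"
    and parity: "AE (x, y, z) in X \<Otimes>\<^sub>M (Y \<Otimes>\<^sub>M Z). f y z * p z x * q x y = - 1"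
  obtains k :: "'x \<Rightarrow> real" and h :: "'y \<Rightarrow> real" and g :: "'z \<Rightarrow> real" where
    "k \<in> borel_measurable X" "h \<in> borel_measurable Y" "g \<in> borel_measurable Z"
    "\<And>x. k x = 1 \<or> k x = - 1" "\<And>y. h y = 1 \<or> h y = - 1" "\<And>z. g z = 1 \<or> g z = - 1"
    "AE (x, y, z) in X \<Otimes>\<^sub>M (Y \<Otimes>\<^sub>M Z).
       f y z = - (h y * g z) \<and> p z x = - (g z * k x) \<and> q x y = - (k x * h y)"
proof -
  interpret X: prob_space X by fact
  interpret Y: prob_space Y by fact
  interpret Z: prob_space Z by fact
  interpret YZ: pair_prob_space Y Z ..
  interpret XYZ: pair_prob_space X "Y \<Otimes>\<^sub>M Z" ..
  have par: "AE x in X. AE w in Y \<Otimes>\<^sub>M Z.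
      f (fst w) (snd w) * p (snd w) x * q x (fst w) = - 1"
    using XYZ.AE_pair[OF parity] by (simp add: case_prod_beta)
  obtain x0 where x0 [measurable]: "x0 \<in> space X"
    and ae0: "AE w in Y \<Otimes>\<^sub>M Z. f (fst w) (snd w) * p (snd w) x0 * q x0 (fst w) = - 1"
    using X.AE_imp_ex[OF par] by auto
  define g where "g z = sign_of (p z x0)" for z
  define h where "h y = sign_of (q x0 y)" for y
  \<comment> \<open>For generic \<open>x\<close> the product \<open>q x y * h y\<close> is almost
    surely a constant sign; integrating over \<open>y\<close> recovers it as a measurable function
    of \<open>x\<close>.\<close>
  define k where "k x = - sign_of (\<integral>y. q x y * h y \<partial>Y)" for x
  have [measurable]: "g \<in> borel_measurable Z" "h \<in> borel_measurable Y"
    unfolding g_def h_def by measurable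
  have [measurable]: "k \<in> borel_measurable X"
    unfolding k_def by measurable
  have g: "g z = 1 \<or> g z = - 1" for z unfolding g_def by (rule sign_of_cases)
  have h: "h y = 1 \<or> h y = - 1" for y unfolding h_def by (rule sign_of_cases)
  have k: "k x = 1 \<or> k x = - 1" for x unfolding k_def using sign_of_cases by force
  have fgh: "AE w in Y \<Otimes>\<^sub>M Z. f (fst w) (snd w) = - (h (fst w) * g (snd w))"
    using ae0 AE_space
  proof eventually_elim
    case (elim w)
    with unit_of_prod_eq_minus_one[OF _ _ _ elim(1)] x0 f p q
    show ?case by (auto simp: g_def h_def sign_of_def space_pair_measure)
  qed
  have "AE x in X. AE w in Y \<Otimes>\<^sub>M Z. f (fst w) (snd w) = - (h (fst w) * g (snd w)) \<and>
      p (snd w) x = - (g (snd w) * k x) \<and> q x (fst w) = - (k x * h (fst w))"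
    using par AE_space
  proof eventually_elim
    case (elim x)
    note x [measurable] = elim(2)
    have "AE w in Y \<Otimes>\<^sub>M Z. p (snd w) x * g (snd w) = q x (fst w) * h (fst w)
        \<and> (q x (fst w) = 1 \<or> q x (fst w) = - 1)"
      using elim(1) fgh AE_space
    proof eventually_elim
      case (elim w)
      with unit_of_prod_eq_minus_one[OF _ _ _ elim(1)] x f p q g[of "snd w"] h[of "fst w"]
      show ?case by (auto simp: space_pair_measure)
    qed
    then have ae: "AE y in Y. AE z in Z. p z x * g z = q x y * h y \<and> (q x y = 1 \<or> q x y = - 1)"
      using YZ.AE_pair by fastforce
    obtain y1 where y1: "AE z in Z. p z x * g z = q x y1 * h y1 \<and> (q x y1 = 1 \<or> q x y1 = - 1)"
      using Y.AE_imp_ex[OF ae] by auto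
    define c where "c = q x y1 * h y1"
    have c: "c = 1 \<or> c = - 1"
      using Z.AE_imp_ex[OF y1] h[of y1] by (auto simp: c_def)
    \<comment> \<open>\<open>y\<close> and \<open>y1\<close> are compared through one
      \<open>z\<close> that is good for both.\<close>
    have q': "AE y in Y. q x y * h y = c"
      using ae
    proof eventually_elim
      case (elim y)
      from Z.AE_imp_ex[OF eventually_conj[OF elim y1]]
      show ?case by (auto simp: c_def)
    qed
    have "(\<integral>y. q x y * h y \<partial>Y) = (\<integral>y. c \<partial>Y)"
      by (rule integral_cong_AE) (use q' in auto)
    then have kx: "k x = - c"
      using c by (simp add: k_def Y.prob_space sign_of_eq)
    have "AE w in Y \<Otimes>\<^sub>M Z. p (snd w) x * g (snd w) = c \<and> q x (fst w) * h (fst w) = c"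
    proof (rule YZ.AE_pair_measure)
      show "{w \<in> space (Y \<Otimes>\<^sub>M Z). p (snd w) x * g (snd w) = c \<and> q x (fst w) * h (fst w) = c}
          \<in> sets (Y \<Otimes>\<^sub>M Z)"
        by measurable
      show "AE y in Y. AE z in Z. p (snd (y, z)) x * g (snd (y, z)) = c \<and>
          q x (fst (y, z)) * h (fst (y, z)) = c"
        using q' y1 by (auto simp: c_def)
    qed
    with fgh show ?case
    proof eventually_elim
      case (elim w)
      then show ?case using g[of "snd w"] h[of "fst w"] kx by auto
    qed
  qed
  then have "AE w in X \<Otimes>\<^sub>M (Y \<Otimes>\<^sub>M Z). case w of (x, y, z) \<Rightarrow>
      f y z = - (h y * g z) \<and> p z x = - (g z * k x) \<and> q x y = - (k x * h y)"
    by (intro XYZ.AE_pair_measure) (auto simp: case_prod_beta)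
  with that[of k h g] g h k show ?thesis by simp
qed

section \<open>Bounded functions and independence\<close>

text \<open>Measurability and bound are bundled because together they survive products and give
  integrability on a probability space.\<close>

definition unit_bounded :: "'w measure \<Rightarrow> ('w \<Rightarrow> real) \<Rightarrow> bool" where
  "unit_bounded M f \<longleftrightarrow> f \<in> borel_measurable M \<and> (\<forall>w\<in>space M. \<bar>f w\<bar> \<le> 1)"

lemma unit_bounded_mult [intro]:
  "unit_bounded M f \<Longrightarrow> unit_bounded M g \<Longrightarrow> unit_bounded M (\<lambda>w. f w * g w)"
  by (auto simp: unit_bounded_def abs_mult mult_le_one)

lemma (in prob_space) integrable_unit_bounded: "unit_bounded M f \<Longrightarrow> integrable M f"
  by (rule integrable_const_bound[where B=1]) (auto simp: unit_bounded_def)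

text \<open>Three cases, by the source separated from the other two: Fubini, then the factor that is
  constant in the other variables is pulled out.\<close>

lemma expectation_independent:
  fixes \<phi> :: "'x \<Rightarrow> real" and \<psi> :: "'y \<Rightarrow> real" and \<theta> :: "'z \<Rightarrow> real"
    and F :: "'y \<Rightarrow> 'z \<Rightarrow> real" and G :: "'z \<Rightarrow> 'x \<Rightarrow> real" and H :: "'x \<Rightarrow> 'y \<Rightarrow> real"
  assumes spaces: "prob_space X" "prob_space Y" "prob_space Z"
  defines "M \<equiv> X \<Otimes>\<^sub>M (Y \<Otimes>\<^sub>M Z)"
  shows "unit_bounded M (\<lambda>w. \<phi> (fst w)) \<Longrightarrow> unit_bounded M (\<lambda>w. F (fst (snd w)) (snd (snd w))) \<Longrightarrow>
      (\<integral>w. \<phi> (fst w) * F (fst (snd w)) (snd (snd w)) \<partial>M)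
        = (\<integral>w. \<phi> (fst w) \<partial>M) * (\<integral>w. F (fst (snd w)) (snd (snd w)) \<partial>M)"
    and "unit_bounded M (\<lambda>w. \<psi> (fst (snd w))) \<Longrightarrow> unit_bounded M (\<lambda>w. G (snd (snd w)) (fst w)) \<Longrightarrow>
      (\<integral>w. \<psi> (fst (snd w)) * G (snd (snd w)) (fst w) \<partial>M)
        = (\<integral>w. \<psi> (fst (snd w)) \<partial>M) * (\<integral>w. G (snd (snd w)) (fst w) \<partial>M)"
    and "unit_bounded M (\<lambda>w. \<theta> (snd (snd w))) \<Longrightarrow> unit_bounded M (\<lambda>w. H (fst w) (fst (snd w))) \<Longrightarrow>
      (\<integral>w. \<theta> (snd (snd w)) * H (fst w) (fst (snd w)) \<partial>M)
        = (\<integral>w. \<theta> (snd (snd w)) \<partial>M) * (\<integral>w. H (fst w) (fst (snd w)) \<partial>M)"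
proof -
  interpret X: prob_space X by fact
  interpret Y: prob_space Y by fact
  interpret Z: prob_space Z by fact
  have iter: "(\<integral>w. f w \<partial>M) = (\<integral>x. \<integral>y. \<integral>z. f (x, y, z) \<partial>Z \<partial>Y \<partial>X)" if "unit_bounded M f" for f
    unfolding M_def
    by (rule integral_triple_eq_iterated[OF spaces, where B=1])
       (use that in \<open>auto simp: unit_bounded_def M_def\<close>)
  show "(\<integral>w. \<phi> (fst w) * F (fst (snd w)) (snd (snd w)) \<partial>M)
        = (\<integral>w. \<phi> (fst w) \<partial>M) * (\<integral>w. F (fst (snd w)) (snd (snd w)) \<partial>M)"
    if u: "unit_bounded M (\<lambda>w. \<phi> (fst w))" "unit_bounded M (\<lambda>w. F (fst (snd w)) (snd (snd w)))"
    by (simp add: iter[OF unit_bounded_mult[OF u]] iter[OF u(1)] iter[OF u(2)]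
        X.prob_space Y.prob_space Z.prob_space)
  show "(\<integral>w. \<psi> (fst (snd w)) * G (snd (snd w)) (fst w) \<partial>M)
        = (\<integral>w. \<psi> (fst (snd w)) \<partial>M) * (\<integral>w. G (snd (snd w)) (fst w) \<partial>M)"
    if u: "unit_bounded M (\<lambda>w. \<psi> (fst (snd w)))" "unit_bounded M (\<lambda>w. G (snd (snd w)) (fst w))"
    by (simp add: iter[OF unit_bounded_mult[OF u]] iter[OF u(1)] iter[OF u(2)]
        X.prob_space Y.prob_space Z.prob_space)
  show "(\<integral>w. \<theta> (snd (snd w)) * H (fst w) (fst (snd w)) \<partial>M)
        = (\<integral>w. \<theta> (snd (snd w)) \<partial>M) * (\<integral>w. H (fst w) (fst (snd w)) \<partial>M)"
    if u: "unit_bounded M (\<lambda>w. \<theta> (snd (snd w)))" "unit_bounded M (\<lambda>w. H (fst w) (fst (snd w)))"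
    by (simp add: iter[OF unit_bounded_mult[OF u]] iter[OF u(1)] iter[OF u(2)]
        X.prob_space Y.prob_space Z.prob_space)
qed

section \<open>Pointwise identities for a signed triangle\<close>

lemma sum_outcome: "(\<Sum>o'\<in>UNIV. f o') = f Zero + f (One False) + f (One True)"
  for f :: "outcome \<Rightarrow> real"
  by (simp add: UNIV_outcome)

text \<open>
  \<open>h\<close>, \<open>g\<close>, \<open>k\<close> are the signs of the sources $\beta$, $\gamma$, $\alpha$.  The locale is
  invariant under the rotation of the parties \<open>a\<close>, \<open>b\<close>, \<open>c\<close> together with these signs, so
  that facts about the party \<open>a\<close> transfer to the others.
\<close>

locale signed_triangle = prob_space M for M :: "'w measure" +
  fixes a b c :: "outcome \<Rightarrow> 'w \<Rightarrow> real" and h g k :: "'w \<Rightarrow> real"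
  assumes unit: "unit_bounded M (a r)" "unit_bounded M (b r)" "unit_bounded M (c r)"
      "unit_bounded M h" "unit_bounded M g" "unit_bounded M k"
    and nonneg: "w \<in> space M \<Longrightarrow> 0 \<le> a r w" "w \<in> space M \<Longrightarrow> 0 \<le> b r w"
      "w \<in> space M \<Longrightarrow> 0 \<le> c r w"
    and total: "w \<in> space M \<Longrightarrow> (\<Sum>r\<in>UNIV. a r w) = 1" "w \<in> space M \<Longrightarrow> (\<Sum>r\<in>UNIV. b r w) = 1"
      "w \<in> space M \<Longrightarrow> (\<Sum>r\<in>UNIV. c r w) = 1"
    and signs: "h w = 1 \<or> h w = - 1" "g w = 1 \<or> g w = - 1" "k w = 1 \<or> k w = - 1"
    and outputs: "AE w in M. 2 * a Zero w = 1 - h w * g w \<and> 2 * b Zero w = 1 - g w * k w \<and>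
      2 * c Zero w = 1 - k w * h w"
begin

lemma rotate: "signed_triangle M b c a g k h"
proof
  show "AE w in M. 2 * b Zero w = 1 - g w * k w \<and> 2 * c Zero w = 1 - k w * h w \<and>
      2 * a Zero w = 1 - h w * g w"
    using outputs by eventually_elim auto
qed (use unit nonneg total signs in auto)

lemma total': "w \<in> space M \<Longrightarrow> a Zero w = 1 - a (One False) w - a (One True) w"
  "w \<in> space M \<Longrightarrow> b Zero w = 1 - b (One False) w - b (One True) w"
  "w \<in> space M \<Longrightarrow> c Zero w = 1 - c (One False) w - c (One True) w"
  using total[of w] unfolding sum_outcome by linarith+

lemmas int_rules = integrable_unit_bounded unit_bounded_mult unit

text \<open>Opposite signs make \<open>Zero\<close> certain, and nonnegative weights leave nothing
  for the other outputs.\<close>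

lemma vanishes:
  assumes "2 * a Zero w = 1 - h w * g w" "w \<in> space M" "h w \<noteq> g w"
  shows "a (One i) w = 0"
proof -
  have "a Zero w = 1"
    using assms(1,3) signs(1,2)[of w] by auto
  then have "a (One False) w + a (One True) w = 0"
    using total'(1)[OF assms(2)] by simp
  then show ?thesis
    using nonneg(1)[OF assms(2), of "One False"] nonneg(1)[OF assms(2), of "One True"]
    by (cases i) auto
qed

text \<open>For \<open>h w \<noteq> g w\<close> both sides vanish. For \<open>h w = g w\<close> the
  factors \<open>b Zero w\<close> and \<open>c Zero w\<close> coincide and are 0 or 1, so their
  product is \<open>(1 - g w * k w) / 2\<close>. This trades three responses for one response and
  signs, where \<open>k\<close> can be split off by independence.\<close>

lemma AE_single: "AE w in M. 2 * (a (One i) w * b Zero w * c Zero w)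
    = a (One i) w - k w * (a (One i) w * g w)"
  using outputs AE_space
proof eventually_elim
  case (elim w)
  then have bc: "b Zero w = (1 - g w * k w) / 2" "c Zero w = (1 - k w * h w) / 2"
    by auto
  show ?case
  proof (cases "h w = g w")
    case True
    with signs(2,3)[of w] show ?thesis by (auto simp: bc)
  next
    case False
    with elim vanishes show ?thesis by simp
  qed
qed

text \<open>Companion of \<open>AE_single\<close>: summing over \<open>j\<close> and
  \<open>l\<close> leaves the factors \<open>1 - b Zero w\<close> and \<open>1 - c Zero w\<close>,
  which coincide and are 0 or 1 when \<open>h w = g w\<close>.\<close>

lemma AE_triple: "AE w in M. 2 * (\<Sum>j\<in>UNIV. \<Sum>l\<in>UNIV. a (One i) w * b (One j) w * c (One l) w)
    = a (One i) w + k w * (a (One i) w * g w)"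
  using outputs AE_space
proof eventually_elim
  case (elim w)
  have *: "(\<Sum>j\<in>UNIV. \<Sum>l\<in>UNIV. a (One i) w * b (One j) w * c (One l) w)
      = a (One i) w * (1 - b Zero w) * (1 - c Zero w)"
    by (simp add: UNIV_bool total'(2,3)[OF elim(2)] algebra_simps)
  from elim have bc: "b Zero w = (1 - g w * k w) / 2" "c Zero w = (1 - k w * h w) / 2"
    by auto
  show ?case
  proof (cases "h w = g w")
    case True
    with signs(2,3)[of w] show ?thesis unfolding * by (auto simp: bc)
  next
    case False
    with elim vanishes show ?thesis by simp
  qed
qed

text \<open>
  The dual certificate.  On $h = g = k = 1$ it reads $n - 1 \le 2, 1, 0, 1$ for $n = 3, 2, 1, 0$
  outputs \<open>One False\<close>, averaged over independent outputs, and on $h = g = k = -1$ it reads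
  $1 - n \le 2, 1, 0, 1$.
\<close>

lemma AE_pointwise_bound:
  "AE w in M.
    a (One False) w * (1 + g w) * (1 + k w) / 4 + b (One False) w * (1 + k w) * (1 + h w) / 4
    + c (One False) w * (1 + h w) * (1 + g w) / 4
    + a (One True) w * (1 - g w) * (1 - k w) / 4 + b (One True) w * (1 - k w) * (1 - h w) / 4
    + c (One True) w * (1 - h w) * (1 - g w) / 4
    - (1 + h w) * (1 + g w) * (1 + k w) / 8 - (1 - h w) * (1 - g w) * (1 - k w) / 4
    \<le> 2 * (a (One False) w * b (One False) w * c (One False) w)
    + a (One False) w * b (One False) w * c (One True) w
    + a (One False) w * b (One True) w * c (One False) w
    + a (One True) w * b (One False) w * c (One False) w
    + a (One True) w * b (One True) w * c (One True) w"
  using outputs AE_space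
proof eventually_elim
  case (elim w)
  interpret B: signed_triangle M b c a g k h by (rule rotate)
  interpret C: signed_triangle M c a b k h g by (rule B.rotate)
  have van: "h w \<noteq> g w \<Longrightarrow> a (One i) w = 0" "g w \<noteq> k w \<Longrightarrow> b (One i) w = 0"
    "k w \<noteq> h w \<Longrightarrow> c (One i) w = 0" for i
    using vanishes[of w i] B.vanishes[of w i] C.vanishes[of w i] elim by auto
  show ?case
  proof (cases "h w = g w \<and> g w = k w")
    case True
    define x y z where "x = a (One False) w" and "y = b (One False) w" and "z = c (One False) w"
    have T: "a (One True) w = 1 - x" "b (One True) w = 1 - y" "c (One True) w = 1 - z"
      using True elim signs[of w] total'[OF elim(2)] by (auto simp: x_def y_def z_def)
    have pos: "0 \<le> x" "0 \<le> y" "0 \<le> z" "0 \<le> 1 - x" "0 \<le> 1 - y" "0 \<le> 1 - z"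
      using nonneg[OF elim(2), of "One False"] nonneg[OF elim(2), of "One True"] T
      by (auto simp: x_def y_def z_def)
    \<comment> \<open>The slack is 2(1-x)(1-y)(1-z) when the common sign is 1, and 4xyz + 2(xy(1-z)
      + x(1-y)z + (1-x)yz) when it is -1.\<close>
    have "0 \<le> (1 - x) * (1 - y) * (1 - z)"
      "0 \<le> x * y * z" "0 \<le> x * y * (1 - z)" "0 \<le> x * (1 - y) * z" "0 \<le> (1 - x) * y * z"
      using pos by simp_all
    then show ?thesis
      unfolding T x_def[symmetric] y_def[symmetric] z_def[symmetric]
      using True signs(1)[of w] by (cases "k w = 1") (auto simp: field_simps)
  next
    case False
    \<comment> \<open>Exactly two signs agree, so two parties have no mass on \<open>One\<close>,
      which kills every product on the right. On the left the third party is weighted by factors of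
      two opposite signs, which give 0, as do both indicator terms.\<close>
    then consider "h w = g w" "g w = - k w" | "g w = k w" "k w = - h w" | "k w = h w" "h w = - g w"
      using signs[of w] by auto
    then show ?thesis
      using signs[of w] van by cases auto
  qed
qed

end

section \<open>Moments forced by \<open>P_Q\<close>\<close>

lemma P_Q_rotate: "P_Q l0 l1 u v r s t = P_Q l0 l1 u v s t r"
  by (cases "(l0, l1, u, v, r, s, t)" rule: P_Q.cases) (auto simp: P_three_def mult_ac)

text \<open>Independence enters only through these moments; the first six split off the sign of the
  source that a party does not see. Stated so, the locale needs no product structure on
  \<open>M\<close> and is closed under rotation and under reversal of all signs.\<close>

locale quantum_triangle = signed_triangle +
  fixes l0 l1 u v :: real
  assumes dist: "expectation (\<lambda>w. a r w * b s w * c t w) = P_Q l0 l1 u v r s t"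
    and indep: "expectation (\<lambda>w. k w * a r w) = expectation k * expectation (a r)"
      "expectation (\<lambda>w. h w * b r w) = expectation h * expectation (b r)"
      "expectation (\<lambda>w. g w * c r w) = expectation g * expectation (c r)"
      "expectation (\<lambda>w. k w * (a r w * g w)) = expectation k * expectation (\<lambda>w. a r w * g w)"
      "expectation (\<lambda>w. h w * (b r w * k w)) = expectation h * expectation (\<lambda>w. b r w * k w)"
      "expectation (\<lambda>w. g w * (c r w * h w)) = expectation g * expectation (\<lambda>w. c r w * h w)"
      "expectation (\<lambda>w. h w * g w) = expectation h * expectation g"
      "expectation (\<lambda>w. g w * k w) = expectation g * expectation k"
      "expectation (\<lambda>w. k w * h w) = expectation k * expectation h"
      "expectation (\<lambda>w. h w * g w * k w) = expectation h * expectation g * expectation k"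
begin

lemma quantum_rotate: "quantum_triangle M b c a g k h l0 l1 u v"
proof -
  interpret B: signed_triangle M b c a g k h by (rule rotate)
  show ?thesis
  proof
    show "expectation (\<lambda>w. b r w * c s w * a t w) = P_Q l0 l1 u v r s t" for r s t
      using dist[of t r s] P_Q_rotate[of l0 l1 u v t r s] by (simp add: mult_ac)
    show "expectation (\<lambda>w. g w * k w * h w) = expectation g * expectation k * expectation h"
      using indep(10) by (simp add: mult_ac)
  qed (rule indep)+
qed

text \<open>The outputs depend on the signs only through products of two: this is the simultaneous
  flip that \<open>P_Q\<close> cannot detect.\<close>

lemma quantum_flip:
  "quantum_triangle M a b c (\<lambda>w. - h w) (\<lambda>w. - g w) (\<lambda>w. - k w) l0 l1 u v"
proof
  show "unit_bounded M (\<lambda>w. - h w)" "unit_bounded M (\<lambda>w. - g w)" "unit_bounded M (\<lambda>w. - k w)"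
    using unit by (auto simp: unit_bounded_def)
  show "- h w = 1 \<or> - h w = - 1" "- g w = 1 \<or> - g w = - 1" "- k w = 1 \<or> - k w = - 1" for w
    using signs[of w] by auto
qed (use unit nonneg total outputs dist indep in auto)

text \<open>Both sides are four times the probability that only party \<open>a\<close> outputs some
  \<open>One\<close>. In terms of the signs it is the mean of (1 + hg)(1 - gk)(1 - kh)/8, which for
  values 1 and -1 equals (1 + hg - gk - kh)/4.\<close>

lemma sign_correlation_relation:
  assumes "u\<^sup>2 + v\<^sup>2 = 1" "l0\<^sup>2 + l1\<^sup>2 = 1"
  shows "1 + expectation h * expectation g - expectation g * expectation k
    - expectation k * expectation h = 4 * (l0\<^sup>2 * l1\<^sup>2)"
proof -
  have "AE w in M. 1 + h w * g w - g w * k w - k w * h w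
      = 4 * (a (One False) w * b Zero w * c Zero w + a (One True) w * b Zero w * c Zero w)"
    using outputs AE_space
  proof eventually_elim
    case (elim w)
    have "a (One False) w * b Zero w * c Zero w + a (One True) w * b Zero w * c Zero w
       = (1 - a Zero w) * b Zero w * c Zero w"
      by (simp add: total'(1)[OF elim(2)] algebra_simps)
    also have "\<dots> = (1 + h w * g w) / 2 * ((1 - g w * k w) / 2) * ((1 - k w * h w) / 2)"
    proof -
      have "a Zero w = (1 - h w * g w) / 2" "b Zero w = (1 - g w * k w) / 2"
        "c Zero w = (1 - k w * h w) / 2"
        using elim by auto
      then show ?thesis by (simp only:) (simp add: field_simps)
    qed
    finally show ?case
      using signs[of w] by auto
  qed
  then have "expectation (\<lambda>w. 1 + h w * g w - g w * k w - k w * h w)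
      = expectation (\<lambda>w. 4 * (a (One False) w * b Zero w * c Zero w
          + a (One True) w * b Zero w * c Zero w))"
    by (intro integral_cong_AE borel_measurable_integrable) (simp_all add: int_rules)
  also have "\<dots> = 4 * (P_one l0 l1 u v False + P_one l0 l1 u v True)"
    by (simp add: dist int_rules)
  also have "P_one l0 l1 u v False + P_one l0 l1 u v True
      = (u\<^sup>2 + v\<^sup>2) * (l0\<^sup>2 + l1\<^sup>2) * (l0\<^sup>2 * l1\<^sup>2)"
    by (simp add: P_one_def coeff_u_def coeff_v_def) algebra
  finally show ?thesis
    using assms by (simp add: int_rules prob_space indep)
qed

text \<open>With \<open>k\<close> split off, \<open>AE_single\<close> and \<open>AE_triple\<close>
  become linear equations giving S - DW and S + DW, where D is the mean of \<open>k\<close>. Their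
  sum yields \<open>S\<close>; recovering \<open>W\<close> divides by D, hence
  \<open>l1\<^sup>2 \<noteq> l0\<^sup>2\<close>.\<close>

lemma moments:
  assumes norm: "u\<^sup>2 + v\<^sup>2 = 1" "l0\<^sup>2 + l1\<^sup>2 = 1"
    and d: "expectation k = l1\<^sup>2 - l0\<^sup>2" "l1\<^sup>2 \<noteq> l0\<^sup>2"
  shows "expectation (a (One i)) = l1 ^ 4 * (coeff_u u v i)\<^sup>2 + l0 ^ 4 * (coeff_v u v i)\<^sup>2"
    and "expectation (\<lambda>w. a (One i) w * g w)
      = l1 ^ 4 * (coeff_u u v i)\<^sup>2 - l0 ^ 4 * (coeff_v u v i)\<^sup>2"
proof -
  define U where "U = (coeff_u u v i)\<^sup>2"
  define V where "V = (coeff_v u v i)\<^sup>2"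
  define S where "S = expectation (a (One i))"
  define W where "W = expectation (\<lambda>w. a (One i) w * g w)"
  have "expectation (\<lambda>w. 2 * (a (One i) w * b Zero w * c Zero w))
      = expectation (\<lambda>w. a (One i) w - k w * (a (One i) w * g w))"
    using AE_single[of i]
    by (intro integral_cong_AE borel_measurable_integrable) (simp_all add: int_rules)
  then have one: "2 * P_one l0 l1 u v i = S - (l1\<^sup>2 - l0\<^sup>2) * W"
    by (simp add: dist int_rules indep d S_def W_def)
  have "expectation (\<lambda>w. 2 * (\<Sum>j\<in>UNIV. \<Sum>l\<in>UNIV. a (One i) w * b (One j) w * c (One l) w))
      = expectation (\<lambda>w. a (One i) w + k w * (a (One i) w * g w))"
    using AE_triple[of i]
    by (intro integral_cong_AE borel_measurable_integrable) (simp_all add: int_rules)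
  then have "2 * (\<Sum>j\<in>UNIV. \<Sum>l\<in>UNIV. P_three l0 l1 u v i j l) = S + (l1\<^sup>2 - l0\<^sup>2) * W"
    by (simp add: dist int_rules indep d S_def W_def UNIV_bool)
  \<comment> \<open>The interference term drops out of the sum: as vectors indexed by the output,
    \<open>coeff_u\<close> and \<open>coeff_v\<close> are orthogonal and of squared length
    \<open>u\<^sup>2 + v\<^sup>2\<close>.\<close>
  moreover have "(\<Sum>j\<in>UNIV. \<Sum>l\<in>UNIV. P_three l0 l1 u v i j l)
      = (u\<^sup>2 + v\<^sup>2)\<^sup>2 * (l1 ^ 6 * U + l0 ^ 6 * V)"
    by (simp add: UNIV_bool P_three_def coeff_u_def coeff_v_def U_def V_def) algebra
  ultimately have three: "2 * (l1 ^ 6 * U + l0 ^ 6 * V) = S + (l1\<^sup>2 - l0\<^sup>2) * W"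
    using norm by simp
  have one': "2 * (l1 ^ 4 * l0\<^sup>2 * U + l0 ^ 4 * l1\<^sup>2 * V) = S - (l1\<^sup>2 - l0\<^sup>2) * W"
    using one by (simp add: P_one_def U_def V_def)
  have "S = (l0\<^sup>2 + l1\<^sup>2) * (l1 ^ 4 * U + l0 ^ 4 * V)"
    using one' three by algebra
  then show "expectation (a (One i)) = l1 ^ 4 * (coeff_u u v i)\<^sup>2 + l0 ^ 4 * (coeff_v u v i)\<^sup>2"
    using norm by (simp add: S_def U_def V_def)
  have "(l1\<^sup>2 - l0\<^sup>2) * W = (l1\<^sup>2 - l0\<^sup>2) * (l1 ^ 4 * U - l0 ^ 4 * V)"
    using one' three by algebra
  then show "expectation (\<lambda>w. a (One i) w * g w)
      = l1 ^ 4 * (coeff_u u v i)\<^sup>2 - l0 ^ 4 * (coeff_v u v i)\<^sup>2"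
    using d by (simp add: W_def U_def V_def)
qed

text \<open>The weights are the indicators of \<open>g\<close> and \<open>k\<close> both being 1, or
  both -1; as \<open>a\<close> outputs \<open>One\<close> only when \<open>h\<close> and
  \<open>g\<close> agree, this is the joint law with the common direction. The mean of (1 + k)/2 is
  l1^2 and splits off from l1^4 u^2; likewise for -1, where \<open>coeff_v u v True\<close> is
  \<open>- u\<close>.\<close>

lemma aligned_moments:
  assumes norm: "u\<^sup>2 + v\<^sup>2 = 1" "l0\<^sup>2 + l1\<^sup>2 = 1"
    and d: "expectation k = l1\<^sup>2 - l0\<^sup>2" "l1\<^sup>2 \<noteq> l0\<^sup>2"
  shows "expectation (\<lambda>w. a (One False) w * (1 + g w) * (1 + k w) / 4) = l1 ^ 6 * u\<^sup>2"
    and "expectation (\<lambda>w. a (One True) w * (1 - g w) * (1 - k w) / 4) = l0 ^ 6 * u\<^sup>2"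
    and "integrable M (\<lambda>w. a (One i) w * (1 + g w) * (1 + k w) / 4)"
    and "integrable M (\<lambda>w. a (One i) w * (1 - g w) * (1 - k w) / 4)"
proof -
  have e: "a (One i) w * (1 + g w) * (1 + k w) / 4
      = (a (One i) w + a (One i) w * g w + k w * a (One i) w + k w * (a (One i) w * g w)) / 4"
    "a (One i) w * (1 - g w) * (1 - k w) / 4
      = (a (One i) w - a (One i) w * g w - k w * a (One i) w + k w * (a (One i) w * g w)) / 4"
    for i w by (simp_all add: algebra_simps)
  have l0: "l0\<^sup>2 = 1 - l1\<^sup>2" using norm by simp
  show "expectation (\<lambda>w. a (One False) w * (1 + g w) * (1 + k w) / 4) = l1 ^ 6 * u\<^sup>2"
    unfolding e
    by (simp add: int_rules indep moments[OF norm d] d(1) coeff_u_def coeff_v_def)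
       (use l0 in algebra)
  show "expectation (\<lambda>w. a (One True) w * (1 - g w) * (1 - k w) / 4) = l0 ^ 6 * u\<^sup>2"
    unfolding e
    by (simp add: int_rules indep moments[OF norm d] d(1) coeff_u_def coeff_v_def)
       (use l0 in algebra)
  show "integrable M (\<lambda>w. a (One i) w * (1 + g w) * (1 + k w) / 4)"
    "integrable M (\<lambda>w. a (One i) w * (1 - g w) * (1 - k w) / 4)"
    unfolding e by (simp_all add: int_rules)
qed

section \<open>The inequality implied by the pointwise certificate\<close>

text \<open>\<open>AE_pointwise_bound\<close> is integrated: its left side through
  \<open>aligned_moments\<close> and the two rotations, its right side through
  \<open>P_three\<close>.\<close>

lemma quantum_bound_oriented:
  assumes norm: "u\<^sup>2 + v\<^sup>2 = 1" "l0\<^sup>2 + l1\<^sup>2 = 1"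
    and d: "expectation h = l1\<^sup>2 - l0\<^sup>2" "expectation g = l1\<^sup>2 - l0\<^sup>2"
      "expectation k = l1\<^sup>2 - l0\<^sup>2" "l1\<^sup>2 \<noteq> l0\<^sup>2"
  shows "3 * u\<^sup>2 * (l1 ^ 6 + l0 ^ 6) - l1 ^ 6 - 2 * l0 ^ 6
    \<le> 3 * (l1 ^ 3 * u\<^sup>2 * v - l0 ^ 3 * u * v\<^sup>2)\<^sup>2 + 2 * (l1 ^ 3 * u ^ 3 + l0 ^ 3 * v ^ 3)\<^sup>2
      + (l1 ^ 3 * v ^ 3 - l0 ^ 3 * u ^ 3)\<^sup>2"
proof -
  interpret B: quantum_triangle M b c a g k h l0 l1 u v by (rule quantum_rotate)
  interpret C: quantum_triangle M c a b k h g l0 l1 u v by (rule B.quantum_rotate)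
  note am = aligned_moments[OF norm d(3,4)] B.aligned_moments[OF norm d(1,4)]
    C.aligned_moments[OF norm d(2,4)]
  have e: "(1 + h w) * (1 + g w) * (1 + k w) / 8
      = (1 + h w + g w + k w + h w * g w + g w * k w + k w * h w + h w * g w * k w) / 8"
    "(1 - h w) * (1 - g w) * (1 - k w) / 4
      = (1 - h w - g w - k w + h w * g w + g w * k w + k w * h w - h w * g w * k w) / 4"
    for w by (simp_all add: algebra_simps)
  have l0: "l0\<^sup>2 = 1 - l1\<^sup>2" using norm by simp
  have plus: "integrable M (\<lambda>w. (1 + h w) * (1 + g w) * (1 + k w) / 8)"
    "expectation (\<lambda>w. (1 + h w) * (1 + g w) * (1 + k w) / 8) = l1 ^ 6"
    unfolding e
    by (simp add: int_rules) (simp add: int_rules indep d(1-3) prob_space, use l0 in algebra)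
  \<comment> \<open>The denominator 4 in place of 8 is the dual weight 2 on the event that all three
    signs are -1, which has probability l0^6.\<close>
  have minus: "integrable M (\<lambda>w. (1 - h w) * (1 - g w) * (1 - k w) / 4)"
    "expectation (\<lambda>w. (1 - h w) * (1 - g w) * (1 - k w) / 4) = 2 * l0 ^ 6"
    unfolding e
    by (simp add: int_rules) (simp add: int_rules indep d(1-3) prob_space, use l0 in algebra)
  define A\<^sub>1 where "A\<^sub>1 w = a (One False) w * (1 + g w) * (1 + k w) / 4" for w
  define B\<^sub>1 where "B\<^sub>1 w = b (One False) w * (1 + k w) * (1 + h w) / 4" for w
  define C\<^sub>1 where "C\<^sub>1 w = c (One False) w * (1 + h w) * (1 + g w) / 4" for w
  define A\<^sub>0 where "A\<^sub>0 w = a (One True) w * (1 - g w) * (1 - k w) / 4" for w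
  define B\<^sub>0 where "B\<^sub>0 w = b (One True) w * (1 - k w) * (1 - h w) / 4" for w
  define C\<^sub>0 where "C\<^sub>0 w = c (One True) w * (1 - h w) * (1 - g w) / 4" for w
  define I\<^sub>1 where "I\<^sub>1 w = (1 + h w) * (1 + g w) * (1 + k w) / 8" for w
  define I\<^sub>0 where "I\<^sub>0 w = (1 - h w) * (1 - g w) * (1 - k w) / 4" for w
  note defs = A\<^sub>1_def B\<^sub>1_def C\<^sub>1_def A\<^sub>0_def B\<^sub>0_def C\<^sub>0_def I\<^sub>1_def I\<^sub>0_def
  have ints: "integrable M A\<^sub>1" "integrable M B\<^sub>1" "integrable M C\<^sub>1" "integrable M A\<^sub>0"
    "integrable M B\<^sub>0" "integrable M C\<^sub>0" "integrable M I\<^sub>1" "integrable M I\<^sub>0"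
    unfolding defs by (rule am plus minus)+
  have vals: "expectation A\<^sub>1 = l1 ^ 6 * u\<^sup>2" "expectation B\<^sub>1 = l1 ^ 6 * u\<^sup>2"
    "expectation C\<^sub>1 = l1 ^ 6 * u\<^sup>2" "expectation A\<^sub>0 = l0 ^ 6 * u\<^sup>2"
    "expectation B\<^sub>0 = l0 ^ 6 * u\<^sup>2" "expectation C\<^sub>0 = l0 ^ 6 * u\<^sup>2"
    "expectation I\<^sub>1 = l1 ^ 6" "expectation I\<^sub>0 = 2 * l0 ^ 6"
    unfolding defs by (rule am plus minus)+
  have "AE w in M. A\<^sub>1 w + B\<^sub>1 w + C\<^sub>1 w + A\<^sub>0 w + B\<^sub>0 w + C\<^sub>0 w - I\<^sub>1 w - I\<^sub>0 w
    \<le> 2 * (a (One False) w * b (One False) w * c (One False) w)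
    + a (One False) w * b (One False) w * c (One True) w
    + a (One False) w * b (One True) w * c (One False) w
    + a (One True) w * b (One False) w * c (One False) w
    + a (One True) w * b (One True) w * c (One True) w"
    using AE_pointwise_bound unfolding defs .
  then have "expectation (\<lambda>w. A\<^sub>1 w + B\<^sub>1 w + C\<^sub>1 w + A\<^sub>0 w + B\<^sub>0 w + C\<^sub>0 w - I\<^sub>1 w - I\<^sub>0 w)
    \<le> expectation (\<lambda>w. 2 * (a (One False) w * b (One False) w * c (One False) w)
    + a (One False) w * b (One False) w * c (One True) w
    + a (One False) w * b (One True) w * c (One False) w
    + a (One True) w * b (One False) w * c (One False) w
    + a (One True) w * b (One True) w * c (One True) w)"
    by (rule integral_mono_AE[rotated 2]) (simp_all add: ints int_rules)
  then have "3 * (l1 ^ 6 * u\<^sup>2) + 3 * (l0 ^ 6 * u\<^sup>2) - l1 ^ 6 - 2 * l0 ^ 6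
    \<le> 2 * P_three l0 l1 u v False False False + P_three l0 l1 u v False False True
    + P_three l0 l1 u v False True False + P_three l0 l1 u v True False False
    + P_three l0 l1 u v True True True"
    by (simp add: ints vals dist int_rules) (simp add: mult_ac)
  then show ?thesis
    by (simp add: P_three_def coeff_u_def coeff_v_def power2_eq_square power3_eq_cube algebra_simps)
qed

text \<open>Since d^2 = 1 - 4 l0^2 l1^2, the three rotations of
  \<open>sign_correlation_relation\<close> force all pairwise products of the means to be d^2. With
  d nonzero the means agree, and only their common sign stays open.\<close>

lemma sign_expectations:
  assumes norm: "u\<^sup>2 + v\<^sup>2 = 1" "l0\<^sup>2 + l1\<^sup>2 = 1" and ne: "l1\<^sup>2 \<noteq> l0\<^sup>2"
  obtains "expectation h = l1\<^sup>2 - l0\<^sup>2" "expectation g = l1\<^sup>2 - l0\<^sup>2" "expectation k = l1\<^sup>2 - l0\<^sup>2"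
  | "expectation h = - (l1\<^sup>2 - l0\<^sup>2)" "expectation g = - (l1\<^sup>2 - l0\<^sup>2)"
    "expectation k = - (l1\<^sup>2 - l0\<^sup>2)"
proof -
  interpret B: quantum_triangle M b c a g k h l0 l1 u v by (rule quantum_rotate)
  interpret C: quantum_triangle M c a b k h g l0 l1 u v by (rule B.quantum_rotate)
  define x y z d where "x = expectation h" and "y = expectation g" and "z = expectation k"
    and "d = l1\<^sup>2 - l0\<^sup>2"
  have "d\<^sup>2 = (l0\<^sup>2 + l1\<^sup>2)\<^sup>2 - 4 * (l0\<^sup>2 * l1\<^sup>2)"
    unfolding d_def by algebra
  then have d: "d\<^sup>2 = 1 - 4 * (l0\<^sup>2 * l1\<^sup>2)"
    using norm by simp
  have rel: "1 + x * y - y * z - z * x = 4 * (l0\<^sup>2 * l1\<^sup>2)"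
    "1 + y * z - z * x - x * y = 4 * (l0\<^sup>2 * l1\<^sup>2)"
    "1 + z * x - x * y - y * z = 4 * (l0\<^sup>2 * l1\<^sup>2)"
    using sign_correlation_relation[OF norm] B.sign_correlation_relation[OF norm]
      C.sign_correlation_relation[OF norm] by (simp_all add: x_def y_def z_def)
  \<comment> \<open>Adding two of the relations leaves a single product.\<close>
  then have prods: "x * y = d\<^sup>2" "y * z = d\<^sup>2" "z * x = d\<^sup>2"
    unfolding d by linarith+
  moreover have "d \<noteq> 0"
    using ne by (simp add: d_def)
  ultimately have "y \<noteq> 0" "z \<noteq> 0"
    by auto
  then have "x = z" "x = y"
    using prods by (metis mult.commute mult_right_cancel)+
  then have "x\<^sup>2 = d\<^sup>2"
    using prods by (simp add: power2_eq_square)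
  then have "x = d \<or> x = - d"
    by (simp add: power2_eq_iff)
  with \<open>x = z\<close> \<open>x = y\<close> that show thesis
    unfolding x_def y_def z_def d_def by metis
qed

lemma quantum_bound:
  assumes norm: "u\<^sup>2 + v\<^sup>2 = 1" "l0\<^sup>2 + l1\<^sup>2 = 1" and ne: "l1\<^sup>2 \<noteq> l0\<^sup>2"
  shows "3 * u\<^sup>2 * (l1 ^ 6 + l0 ^ 6) - l1 ^ 6 - 2 * l0 ^ 6
    \<le> 3 * (l1 ^ 3 * u\<^sup>2 * v - l0 ^ 3 * u * v\<^sup>2)\<^sup>2 + 2 * (l1 ^ 3 * u ^ 3 + l0 ^ 3 * v ^ 3)\<^sup>2
      + (l1 ^ 3 * v ^ 3 - l0 ^ 3 * u ^ 3)\<^sup>2"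
proof (rule sign_expectations[OF norm ne])
  assume "expectation h = l1\<^sup>2 - l0\<^sup>2" "expectation g = l1\<^sup>2 - l0\<^sup>2" "expectation k = l1\<^sup>2 - l0\<^sup>2"
  then show ?thesis
    using quantum_bound_oriented[OF norm _ _ _ ne] by blast
next
  \<comment> \<open>Reversing the signs makes the means positive multiples of d again, and the
    inequality itself does not mention the signs.\<close>
  interpret N: quantum_triangle M a b c "\<lambda>w. - h w" "\<lambda>w. - g w" "\<lambda>w. - k w" l0 l1 u v
    by (rule quantum_flip)
  assume "expectation h = - (l1\<^sup>2 - l0\<^sup>2)" "expectation g = - (l1\<^sup>2 - l0\<^sup>2)"
    "expectation k = - (l1\<^sup>2 - l0\<^sup>2)"
  then show ?thesis
    using N.quantum_bound_oriented[OF norm _ _ _ ne] by simp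
qed

end

section \<open>From a triangle-local model to signs of the sources\<close>

text \<open>\<open>P_Q\<close> gives probability 0 to an even number of outputs \<open>One\<close>,
  which is the parity that \<open>triangle_parity_rigidity\<close> asks for; the functions it
  returns, lifted to the product space, are the signs.\<close>

lemma triangle_local_imp_quantum_triangle:
  fixes X :: "'x measure" and Y :: "'y measure" and Z :: "'z measure"
  assumes spaces: "prob_space X" "prob_space Y" "prob_space Z"
    and resp: "response Y Z PA" "response Z X PB" "response X Y PC"
    and P: "\<And>r s t. P_Q l0 l1 u v r s t =
      (\<integral>(x, y, z). PA r y z * PB s z x * PC t x y \<partial>(X \<Otimes>\<^sub>M (Y \<Otimes>\<^sub>M Z)))"
  obtains h g k where "quantum_triangle (X \<Otimes>\<^sub>M (Y \<Otimes>\<^sub>M Z))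
      (\<lambda>r w. PA r (fst (snd w)) (snd (snd w))) (\<lambda>r w. PB r (snd (snd w)) (fst w))
      (\<lambda>r w. PC r (fst w) (fst (snd w))) h g k l0 l1 u v"
proof -
  interpret X: prob_space X by fact
  interpret Y: prob_space Y by fact
  interpret Z: prob_space Z by fact
  interpret YZ: pair_prob_space Y Z ..
  interpret XYZ: pair_prob_space X "Y \<Otimes>\<^sub>M Z" ..
  define M where "M = X \<Otimes>\<^sub>M (Y \<Otimes>\<^sub>M Z)"
  interpret M: prob_space M
    unfolding M_def by unfold_locales
  define a where "a r w = PA r (fst (snd w)) (snd (snd w))" for r and w :: "'x \<times> 'y \<times> 'z"
  define b where "b r w = PB r (snd (snd w)) (fst w)" for r and w :: "'x \<times> 'y \<times> 'z"
  define c where "c r w = PC r (fst w) (fst (snd w))" for r and w :: "'x \<times> 'y \<times> 'z"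
  have [measurable]: "case_prod (PA r) \<in> borel_measurable (Y \<Otimes>\<^sub>M Z)"
    "case_prod (PB r) \<in> borel_measurable (Z \<Otimes>\<^sub>M X)"
    "case_prod (PC r) \<in> borel_measurable (X \<Otimes>\<^sub>M Y)" for r
    using resp by (simp_all add: response_def)
  \<comment> \<open>The second bound concerns the conditional mean of the output's sign.\<close>
  have le1: "\<bar>R r x y\<bar> \<le> 1" "\<bar>2 * R r x y - 1\<bar> \<le> 1"
    if "response S T R" "x \<in> space S" "y \<in> space T"
    for S :: "'s measure" and T :: "'t measure" and R :: "outcome \<Rightarrow> 's \<Rightarrow> 't \<Rightarrow> real" and r x y
  proof -
    have R: "0 \<le> R r x y" "(\<Sum>r\<in>UNIV. R r x y) = 1" for r
      using that by (auto simp: response_def)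
    have "R r x y \<le> (\<Sum>r\<in>UNIV. R r x y)"
      by (rule member_le_sum) (simp_all add: R)
    with R(1)[of r] R(2) show "\<bar>R r x y\<bar> \<le> 1" "\<bar>2 * R r x y - 1\<bar> \<le> 1" by auto
  qed
  have unit: "unit_bounded M (a r)" "unit_bounded M (b r)" "unit_bounded M (c r)" for r
    using le1[OF resp(1)] le1[OF resp(2)] le1[OF resp(3)]
    unfolding unit_bounded_def M_def a_def b_def c_def by (auto simp: space_pair_measure)
  have nonneg: "0 \<le> a r w" "0 \<le> b r w" "0 \<le> c r w"
    and total: "(\<Sum>r\<in>UNIV. a r w) = 1" "(\<Sum>r\<in>UNIV. b r w) = 1" "(\<Sum>r\<in>UNIV. c r w) = 1"
    if "w \<in> space M" for r w
    using that resp
    by (auto simp: M_def space_pair_measure response_def a_def b_def c_def)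
  have dist: "M.expectation (\<lambda>w. a r w * b s w * c t w) = P_Q l0 l1 u v r s t" for r s t
    by (simp add: P M_def a_def b_def c_def case_prod_unfold)
  \<comment> \<open>Given the sources the outputs are independent, so this is the conditional
    probability that 0 or 2 of them are some \<open>One\<close>.\<close>
  define even_part where "even_part w = a Zero w * b Zero w * c Zero w
    + (1 - a Zero w) * (1 - b Zero w) * c Zero w + (1 - a Zero w) * b Zero w * (1 - c Zero w)
    + a Zero w * (1 - b Zero w) * (1 - c Zero w)" for w
  have one_minus: "1 - a Zero w = a (One False) w + a (One True) w"
    "1 - b Zero w = b (One False) w + b (One True) w"
    "1 - c Zero w = c (One False) w + c (One True) w" if "w \<in> space M" for w
    using total[OF that] unfolding sum_outcome by linarith+
  note int_rules = M.integrable_unit_bounded unit_bounded_mult unit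
  \<comment> \<open>The same probability as a sum of products of responses, each with expectation a
    vanishing entry of \<open>P_Q\<close>.\<close>
  define expanded where "expanded w = a Zero w * b Zero w * c Zero w
    + (\<Sum>i\<in>UNIV. \<Sum>j\<in>UNIV. a (One i) w * b (One j) w * c Zero w
      + a (One i) w * b Zero w * c (One j) w + a Zero w * b (One i) w * c (One j) w)" for w
  have eq: "even_part w = expanded w" if "w \<in> space M" for w
    unfolding even_part_def expanded_def one_minus[OF that]
    by (simp add: UNIV_bool algebra_simps)
  have "integrable M expanded" "M.expectation expanded = 0"
    unfolding expanded_def by (simp_all add: int_rules dist)
  then have "integrable M even_part" "M.expectation even_part = 0"
    using Bochner_Integration.integrable_cong[of M M even_part expanded]
      Bochner_Integration.integral_cong[of M M even_part expanded] eq
    by simp_all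
  moreover have "AE w in M. 0 \<le> even_part w"
    by (rule AE_I2)
       (auto simp: eq expanded_def intro!: add_nonneg_nonneg sum_nonneg mult_nonneg_nonneg nonneg)
  ultimately have "AE w in M. even_part w = 0"
    using integral_nonneg_eq_0_iff_AE by blast
  \<comment> \<open>The product of the three mean signs is
    \<open>2 * even_part w - 1\<close>.\<close>
  then have parity: "AE w in M. (2 * a Zero w - 1) * (2 * b Zero w - 1) * (2 * c Zero w - 1) = - 1"
    by eventually_elim (simp add: even_part_def algebra_simps)
  have sign_meas: "case_prod (\<lambda>y z. 2 * PA Zero y z - 1) \<in> borel_measurable (Y \<Otimes>\<^sub>M Z)"
    "case_prod (\<lambda>z x. 2 * PB Zero z x - 1) \<in> borel_measurable (Z \<Otimes>\<^sub>M X)"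
    "case_prod (\<lambda>x y. 2 * PC Zero x y - 1) \<in> borel_measurable (X \<Otimes>\<^sub>M Y)"
    by measurable
  have parity': "AE (x, y, z) in X \<Otimes>\<^sub>M (Y \<Otimes>\<^sub>M Z).
      (2 * PA Zero y z - 1) * (2 * PB Zero z x - 1) * (2 * PC Zero x y - 1) = - 1"
    using parity unfolding M_def a_def b_def c_def case_prod_unfold .
  obtain k h g where [measurable]: "k \<in> borel_measurable X" "h \<in> borel_measurable Y"
      "g \<in> borel_measurable Z"
    and signs: "\<And>x. k x = 1 \<or> k x = - 1" "\<And>y. h y = 1 \<or> h y = - 1" "\<And>z. g z = 1 \<or> g z = - 1"
    and ae: "AE (x, y, z) in X \<Otimes>\<^sub>M (Y \<Otimes>\<^sub>M Z). 2 * PA Zero y z - 1 = - (h y * g z) \<and>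
      2 * PB Zero z x - 1 = - (g z * k x) \<and> 2 * PC Zero x y - 1 = - (k x * h y)"
    using triangle_parity_rigidity[OF spaces sign_meas le1(2)[OF resp(1), of _ _ Zero]
        le1(2)[OF resp(2), of _ _ Zero] le1(2)[OF resp(3), of _ _ Zero] parity']
    by blast
  define hh where "hh w = h (fst (snd w))" for w :: "'x \<times> 'y \<times> 'z"
  define gg where "gg w = g (snd (snd w))" for w :: "'x \<times> 'y \<times> 'z"
  define kk where "kk w = k (fst w)" for w :: "'x \<times> 'y \<times> 'z"
  have abs1: "\<bar>k x\<bar> = 1" "\<bar>h y\<bar> = 1" "\<bar>g z\<bar> = 1" for x y z
    using signs(1)[of x] signs(2)[of y] signs(3)[of z] by auto
  have unit': "unit_bounded M hh" "unit_bounded M gg" "unit_bounded M kk"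
    unfolding unit_bounded_def M_def hh_def gg_def kk_def by (auto simp: abs1)
  note uab = unit unit' unit_bounded_mult[OF unit(1) unit'(2)]
    unit_bounded_mult[OF unit(2) unit'(3)] unit_bounded_mult[OF unit(3) unit'(1)]
    unit_bounded_mult[OF unit'(1) unit'(2)]
  note defs = a_def b_def c_def hh_def gg_def kk_def
  note ind = expectation_independent[OF spaces, folded M_def]
  have hg: "M.expectation (\<lambda>w. hh w * gg w) = M.expectation hh * M.expectation gg"
    using ind(2)[of h "\<lambda>z x. g z"] uab by (simp add: defs[abs_def])
  \<comment> \<open>The threefold product is split in two stages: first \<open>kk\<close>, then
    \<open>hh\<close> from \<open>gg\<close> by \<open>hg\<close>.\<close>
  have khg: "M.expectation (\<lambda>w. kk w * (hh w * gg w))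
      = M.expectation kk * M.expectation (\<lambda>w. hh w * gg w)"
    using ind(1)[of k "\<lambda>y z. h y * g z"] uab by (simp add: defs[abs_def])
  have "quantum_triangle M a b c hh gg kk l0 l1 u v"
  proof
    show "AE w in M. 2 * a Zero w = 1 - hh w * gg w \<and> 2 * b Zero w = 1 - gg w * kk w \<and>
        2 * c Zero w = 1 - kk w * hh w"
      using ae unfolding M_def case_prod_unfold by eventually_elim (simp add: defs)
    show "M.expectation (\<lambda>w. kk w * a r w) = M.expectation kk * M.expectation (a r)"
      "M.expectation (\<lambda>w. kk w * (a r w * gg w))
        = M.expectation kk * M.expectation (\<lambda>w. a r w * gg w)"
      for r
      using ind(1)[of k "PA r"] ind(1)[of k "\<lambda>y z. PA r y z * g z"] uab
      by (simp_all add: defs[abs_def])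
    show "M.expectation (\<lambda>w. hh w * b r w) = M.expectation hh * M.expectation (b r)"
      "M.expectation (\<lambda>w. hh w * (b r w * kk w))
        = M.expectation hh * M.expectation (\<lambda>w. b r w * kk w)"
      for r
      using ind(2)[of h "PB r"] ind(2)[of h "\<lambda>z x. PB r z x * k x"] uab
      by (simp_all add: defs[abs_def])
    show "M.expectation (\<lambda>w. gg w * c r w) = M.expectation gg * M.expectation (c r)"
      "M.expectation (\<lambda>w. gg w * (c r w * hh w))
        = M.expectation gg * M.expectation (\<lambda>w. c r w * hh w)"
      for r
      using ind(3)[of g "PC r"] ind(3)[of g "\<lambda>x y. PC r x y * h y"] uab
      by (simp_all add: defs[abs_def])
    show "M.expectation (\<lambda>w. hh w * gg w) = M.expectation hh * M.expectation gg"
      by (rule hg)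
    show "M.expectation (\<lambda>w. gg w * kk w) = M.expectation gg * M.expectation kk"
      using ind(3)[of g "\<lambda>x y. k x"] uab by (simp add: defs[abs_def])
    show "M.expectation (\<lambda>w. kk w * hh w) = M.expectation kk * M.expectation hh"
      using ind(1)[of k "\<lambda>y z. h y"] uab by (simp add: defs[abs_def])
    show "M.expectation (\<lambda>w. hh w * gg w * kk w)
        = M.expectation hh * M.expectation gg * M.expectation kk"
      using khg hg by (simp add: mult_ac)
  qed (use unit unit' nonneg total dist signs in \<open>auto simp: hh_def gg_def kk_def\<close>)
  then show thesis
    by (intro that[of hh gg kk]) (simp add: M_def a_def[abs_def] b_def[abs_def] c_def[abs_def])
qed

theorem theorem2:
  fixes l0 l1 u v :: real
  assumes "0 < l0" and "0 < l1" and "l0\<^sup>2 + l1\<^sup>2 = 1" and "l0\<^sup>2 \<noteq> 1 / 2"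
    and "0 < v" and "v < u" and "u < 1" and "u\<^sup>2 + v\<^sup>2 = 1"
    and "3 * (l1 ^ 3 * u\<^sup>2 * v - l0 ^ 3 * u * v\<^sup>2)\<^sup>2
         - 3 * u\<^sup>2 * (l1 ^ 6 + l0 ^ 6)
         + 2 * (l0 ^ 6 + (l1 ^ 3 * u ^ 3 + l0 ^ 3 * v ^ 3)\<^sup>2)
         + l1 ^ 6 + (l1 ^ 3 * v ^ 3 - l0 ^ 3 * u ^ 3)\<^sup>2 < 0"
  shows "\<not> triangle_local TYPE('x \<times> 'y \<times> 'z) (P_Q l0 l1 u v)"
proof
  assume "triangle_local TYPE('x \<times> 'y \<times> 'z) (P_Q l0 l1 u v)"
  then obtain X :: "'x measure" and Y :: "'y measure" and Z :: "'z measure" and PA PB PC where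
    spaces: "prob_space X" "prob_space Y" "prob_space Z" and
    resp: "response Y Z PA" "response Z X PB" "response X Y PC" and
    P: "\<And>r s t. P_Q l0 l1 u v r s t =
      (\<integral>(x, y, z). PA r y z * PB s z x * PC t x y \<partial>(X \<Otimes>\<^sub>M (Y \<Otimes>\<^sub>M Z)))"
    unfolding triangle_local_def by blast
  from triangle_local_imp_quantum_triangle[OF spaces resp P]
  obtain h g k where "quantum_triangle (X \<Otimes>\<^sub>M (Y \<Otimes>\<^sub>M Z))
      (\<lambda>r w. PA r (fst (snd w)) (snd (snd w))) (\<lambda>r w. PB r (snd (snd w)) (fst w))
      (\<lambda>r w. PC r (fst w) (fst (snd w))) h g k l0 l1 u v"
    by blast
  then interpret A: quantum_triangle "X \<Otimes>\<^sub>M (Y \<Otimes>\<^sub>M Z)"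
      "\<lambda>r w. PA r (fst (snd w)) (snd (snd w))" "\<lambda>r w. PB r (snd (snd w)) (fst w)"
      "\<lambda>r w. PC r (fst w) (fst (snd w))" h g k l0 l1 u v .
  have "l1\<^sup>2 \<noteq> l0\<^sup>2"
    using assms(3,4) by auto
  \<comment> \<open>Rearranged, the assumed inequality is the strict reverse of this bound.\<close>
  from A.quantum_bound[OF assms(8,3) this] assms(9) show False
    by (simp add: distrib_left)
qed

end
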